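(* Let $p\ge1$, let $G$ be a graph, let $r=\alpha(G)$, let $\Delta=\Delta(G)$, and let $H=\overline G$. The following are equivalent: (a) $G$ is $\alpha$-critical and $G\in\mathbf W_p$; (b) $\Delta$ is pure, every ridge of $\Delta$ has degree at least $p$, and every missing edge of $\Delta$ is contained in the vertex set of the link of some ridge; (c) $G$ is well-covered, $|F_G(S)|\ge p$ for every $S\in\Omega^*(G)$ with $|S|=r-1$, and $E(G)=\bigcup_{S\in\Omega^*(G),\,|S|=r-1}\binom{F_G(S)}{2}$; (d) $H$ is $K_{r+1}$-saturated, every maximal clique of $H$ has size $r$, and $\delta^{\mathrm{cl}}_{r-1}(H)\ge p$.
   Context: All graphs are finite, simple and non-empty. $\Omega^*(G)$ is the family of independent sets, $\alpha(G)$ the independence number, $\Omega(G)$ the maximum independent sets. $G$ is well-covered if all maximal independent sets have size $\alpha(G)$. $G\in\mathbf W_p$ means: $|V(G)|\ge p$ and any $p$ pairwise disjoint independent sets $A_1,\dots,A_p$ extend to pairwise disjoint maximum independent sets $M_i\supseteq A_i$. An edge $e$ is $\alpha$-critical if $\alpha(G-e)>\alpha(G)$; $G$ is $\alpha$-critical if all edges are. $\Delta(G)$ is the simplicial complex of independent sets of $G$; it is pure if all inclusion-maximal faces have the same size. If pure with facets of size $r$, a ridge is a face of size $r-1$; the link of a face $S$ is $\{T\in\Delta: T\cap S=\emptyset,\ S\cup T\in\Delta\}$, and the degree of a ridge is the number of vertices of its link. A missing edge of $\Delta$ is a 2-element non-face all of whose proper subsets are faces (for $\Delta(G)$ these are exactly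 edges of $G$). For independent $S$ with $|S|=r-1$, $F_G(S)=\{x\in V(G)\setminus S:S\cup\{x\}\in\Omega(G)\}$, and $\binom{F}{2}$ is the set of 2-subsets of $F$. A graph $H$ is $K_t$-saturated if it contains no $K_t$ and adding any non-edge creates a $K_t$. $\mathcal K_t(H)$ is the family of $t$-cliques; for $Q\in\mathcal K_{r-1}(H)$, $\operatorname{codeg}_H(Q)=|\{x\in V(H)\setminus Q:Q\cup\{x\}\in\mathcal K_r(H)\}|$ and $\delta^{\mathrm{cl}}_{r-1}(H)$ is the minimum of these over $\mathcal K_{r-1}(H)$, with conventions $\mathcal K_0(H)=\{\emptyset\}$, $\delta^{\mathrm{cl}}_0(H)=|V(H)|$. *)

theory Defs
  imports Main "HOL-Library.Disjoint_Sets" "HOL-Library.Ramsey"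
begin

section \<open>Finite simple graphs\<close>

text \<open>An edge is the 2-element set of its endpoints; \<open>[A]\<^bsup>k\<^esup>\<close> (\<open>nsets\<close>) is the family of
  \<open>k\<close>-element subsets of \<open>A\<close>.\<close>

record 'a graph =
  verts :: "'a set"
  edges :: "'a set set"

definition finite_simple_graph :: "'a graph \<Rightarrow> bool" where
  "finite_simple_graph G \<longleftrightarrow>
     finite (verts G) \<and> verts G \<noteq> {} \<and> edges G \<subseteq> [verts G]\<^bsup>2\<^esup>"

definition complement_graph :: "'a graph \<Rightarrow> 'a graph" where
  "complement_graph G = \<lparr>verts = verts G, edges = [verts G]\<^bsup>2\<^esup> - edges G\<rparr>"

definition delete_edge :: "'a graph \<Rightarrow> 'a set \<Rightarrow> 'a graph" where
  "delete_edge G e = G\<lparr>edges := edges G - {e}\<rparr>"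

definition add_edge :: "'a graph \<Rightarrow> 'a set \<Rightarrow> 'a graph" where
  "add_edge G e = G\<lparr>edges := insert e (edges G)\<rparr>"

definition inclusion_maximal :: "'a set set \<Rightarrow> 'a set set" where
  "inclusion_maximal K = {M \<in> K. \<forall>N\<in>K. M \<subseteq> N \<longrightarrow> N = M}"


section \<open>Independent sets\<close>

definition indep_sets :: "'a graph \<Rightarrow> 'a set set" where
  "indep_sets G = {S. S \<subseteq> verts G \<and> (\<forall>e\<in>edges G. \<not> e \<subseteq> S)}"

definition indep_number :: "'a graph \<Rightarrow> nat" where
  "indep_number G = Max (card ` indep_sets G)"

definition maximum_indep_sets :: "'a graph \<Rightarrow> 'a set set" where
  "maximum_indep_sets G = {S \<in> indep_sets G. card S = indep_number G}"

definition well_covered :: "'a graph \<Rightarrow> bool" where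
  "well_covered G \<longleftrightarrow> (\<forall>S\<in>inclusion_maximal (indep_sets G). card S = indep_number G)"

text \<open>The sets \<open>A i\<close> may be empty, and several of them may be empty at once.\<close>

definition W_class :: "nat \<Rightarrow> 'a graph set" where
  "W_class p = {G. finite_simple_graph G \<and> p \<le> card (verts G) \<and>
     (\<forall>A. (\<forall>i<p. A i \<in> indep_sets G) \<and> disjoint_family_on A {..<p} \<longrightarrow>
        (\<exists>M. (\<forall>i<p. M i \<in> maximum_indep_sets G \<and> A i \<subseteq> M i) \<and>
             disjoint_family_on M {..<p}))}"

definition alpha_critical_edge :: "'a graph \<Rightarrow> 'a set \<Rightarrow> bool" where
  "alpha_critical_edge G e \<longleftrightarrow> indep_number (delete_edge G e) > indep_number G"

definition alpha_critical :: "'a graph \<Rightarrow> bool" where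
  "alpha_critical G \<longleftrightarrow> (\<forall>e\<in>edges G. alpha_critical_edge G e)"

definition ext_set :: "'a graph \<Rightarrow> 'a set \<Rightarrow> 'a set" where
  "ext_set G S = {x \<in> verts G - S. S \<union> {x} \<in> maximum_indep_sets G}"


section \<open>Simplicial complexes\<close>

text \<open>A complex is the set of its faces, the empty face included; the independence complex
  of \<open>G\<close> is therefore \<open>indep_sets G\<close> itself.\<close>

definition pure_complex :: "'a set set \<Rightarrow> bool" where
  "pure_complex K \<longleftrightarrow>
     (\<forall>F\<in>inclusion_maximal K. \<forall>F'\<in>inclusion_maximal K. card F = card F')"

text \<open>Only used for pure complexes, where all facets \<open>F\<close> have the same size.\<close>

definition ridges :: "'a set set \<Rightarrow> 'a set set" where
  "ridges K = {S \<in> K. \<exists>F\<in>inclusion_maximal K. card F = card S + 1}"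

definition link :: "'a set set \<Rightarrow> 'a set \<Rightarrow> 'a set set" where
  "link K S = {T \<in> K. T \<inter> S = {} \<and> S \<union> T \<in> K}"

definition complex_verts :: "'a set set \<Rightarrow> 'a set" where
  "complex_verts K = {v. {v} \<in> K}"

definition ridge_degree :: "'a set set \<Rightarrow> 'a set \<Rightarrow> nat" where
  "ridge_degree K S = card (complex_verts (link K S))"

definition missing_edges :: "'a set set \<Rightarrow> 'a set set" where
  "missing_edges K = {e. card e = 2 \<and> e \<notin> K \<and> (\<forall>T. T \<subset> e \<longrightarrow> T \<in> K)}"


section \<open>Cliques\<close>

definition clique_sets :: "'a graph \<Rightarrow> 'a set set" where
  "clique_sets H = {Q. Q \<subseteq> verts H \<and> [Q]\<^bsup>2\<^esup> \<subseteq> edges H}"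

definition k_cliques :: "nat \<Rightarrow> 'a graph \<Rightarrow> 'a set set" where
  "k_cliques t H = {Q \<in> clique_sets H. card Q = t}"

definition clique_saturated :: "nat \<Rightarrow> 'a graph \<Rightarrow> bool" where
  "clique_saturated t H \<longleftrightarrow> k_cliques t H = {} \<and>
     (\<forall>e\<in>[verts H]\<^bsup>2\<^esup> - edges H. k_cliques t (add_edge H e) \<noteq> {})"

definition clique_codegree :: "'a graph \<Rightarrow> 'a set \<Rightarrow> nat" where
  "clique_codegree H Q =
     card {x \<in> verts H - Q. Q \<union> {x} \<in> k_cliques (card Q + 1) H}"

text \<open>The conventions for \<open>k = 0\<close> hold without a separate case: the only 0-clique is the
  empty set, and its codegree is the number of vertices.  The minimum is only meaningful
  if \<open>H\<close> has a \<open>k\<close>-clique.\<close>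

definition min_clique_codegree :: "nat \<Rightarrow> 'a graph \<Rightarrow> nat" where
  "min_clique_codegree k H = Min (clique_codegree H ` k_cliques k H)"

end

theory Submission
  imports Defs
begin

text \<open>
  Let \<open>r = \<alpha>(G)\<close> and let \<open>S\<close> be independent of size \<open>r - 1\<close>. Two non-adjacent vertices of \<open>F(S)\<close>
  would give an independent set of size \<open>r + 1\<close>, so \<open>F(S)\<close> is a clique. Hence \<open>p - 1\<close> independent
  sets cannot cover \<open>F(S)\<close> if \<open>|F(S)| \<ge> p\<close>; therefore, in a well-covered graph with all
  \<open>|F(S)| \<ge> p\<close>, any independent set extends to a maximum one avoiding \<open>p - 1\<close> given disjoint
  independent sets, and \<open>G \<in> \<^bold>W\<^sub>p\<close> follows by extending one set after the other. Conversely, if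
  \<open>|F(S)| < p\<close>, then \<open>S\<close> and the singletons of \<open>F(S)\<close> violate \<open>\<^bold>W\<^sub>p\<close>. An edge is
  \<open>\<alpha>\<close>-critical iff it lies in some \<open>F(S)\<close>, because \<open>S\<close> plus the edge is then independent of
  size \<open>r + 1\<close> in \<open>G - e\<close>. Conditions (b) and (d) are translations: \<open>F(S)\<close> is the vertex set of
  the link of the ridge \<open>S\<close>, and the cliques of the complement are the independent sets.
\<close>

section \<open>Maximal members of set families and two-element sets\<close>

lemma inclusion_maximal_above:
  assumes "finite K" "S \<in> K"
  obtains M where "M \<in> inclusion_maximal K" "S \<subseteq> M"
proof -
  obtain M where "M \<in> K" "S \<subseteq> M" "\<And>N. N \<in> K \<Longrightarrow> M \<subseteq> N \<Longrightarrow> M = N"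
    using finite_has_maximal2[OF assms] by metis
  then show ?thesis
    by (intro that[of M]) (auto simp: inclusion_maximal_def)
qed

lemma indep_sets_subset: "S \<in> indep_sets G \<Longrightarrow> T \<subseteq> S \<Longrightarrow> T \<in> indep_sets G"
  unfolding indep_sets_def by blast

text \<open>Finiteness comes for free: an infinite set has cardinality 0, not 2.\<close>

lemma nsets_2_iff: "e \<in> [A]\<^bsup>2\<^esup> \<longleftrightarrow> e \<subseteq> A \<and> card e = 2"
  unfolding nsets_def using card.infinite by fastforce

section \<open>Independent sets of a finite graph\<close>

locale fin_graph =
  fixes G :: "'a graph"
  assumes fsg: "finite_simple_graph G"
begin

abbreviation "I \<equiv> indep_sets G"
abbreviation "r \<equiv> indep_number G"
abbreviation "F \<equiv> ext_set G"

lemma fin_verts: "finite (verts G)"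
  using fsg unfolding finite_simple_graph_def by blast

lemma edge_card: "e \<in> edges G \<Longrightarrow> card e = 2"
  and edge_verts: "e \<in> edges G \<Longrightarrow> e \<subseteq> verts G"
  using fsg unfolding finite_simple_graph_def by (meson nsets_2_iff subsetD)+

lemma indep_finite: "S \<in> I \<Longrightarrow> finite S"
  unfolding indep_sets_def using fin_verts finite_subset by blast

lemma finite_indep_sets: "finite I"
  by (rule finite_subset[of _ "Pow (verts G)"]) (auto simp: indep_sets_def fin_verts)

lemma empty_indep: "{} \<in> I"
  unfolding indep_sets_def using edge_card by fastforce

lemma singleton_indep: "{v} \<in> I \<longleftrightarrow> v \<in> verts G"
proof -
  have "\<not> e \<subseteq> {v}" if "e \<in> edges G" for e
    using edge_card[OF that] card_mono[of "{v}" e] by auto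
  then show ?thesis
    unfolding indep_sets_def by auto
qed

lemma indep_card_le: "S \<in> I \<Longrightarrow> card S \<le> r"
  unfolding indep_number_def using finite_indep_sets by auto

lemma maximum_indep_exists: obtains M where "M \<in> maximum_indep_sets G"
proof -
  have "r \<in> card ` I"
    unfolding indep_number_def using finite_indep_sets empty_indep by (intro Max_in) auto
  then show ?thesis
    using that unfolding maximum_indep_sets_def by auto
qed

lemma indep_number_pos: "r \<ge> 1"
proof -
  obtain v where "v \<in> verts G"
    using fsg unfolding finite_simple_graph_def by blast
  then show ?thesis
    using indep_card_le[of "{v}"] singleton_indep by simp
qed

lemma maximum_imp_maximal:
  assumes "M \<in> maximum_indep_sets G" shows "M \<in> inclusion_maximal I"
proof -
  have M: "M \<in> I" "card M = r"
    using assms unfolding maximum_indep_sets_def by auto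
  have "N = M" if "N \<in> I" "M \<subseteq> N" for N
    using card_seteq[OF indep_finite[OF that(1)] that(2)] indep_card_le[OF that(1)] M by simp
  with M show ?thesis
    unfolding inclusion_maximal_def by blast
qed

lemma indep_of_card_exists:
  assumes "k \<le> r" obtains S where "S \<in> I" "card S = k"
proof -
  obtain M where M: "M \<in> maximum_indep_sets G"
    by (rule maximum_indep_exists)
  then obtain S where "S \<subseteq> M" "card S = k"
    using assms obtain_subset_with_card_n[of k M] unfolding maximum_indep_sets_def by auto
  with M that show ?thesis
    unfolding maximum_indep_sets_def using indep_sets_subset by blast
qed

lemma well_covered_extend:
  assumes "well_covered G" "S \<in> I"
  obtains M where "M \<in> maximum_indep_sets G" "S \<subseteq> M"
proof -
  obtain M where M: "M \<in> inclusion_maximal I" "S \<subseteq> M"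
    using inclusion_maximal_above[OF finite_indep_sets assms(2)] by blast
  with assms(1) have "M \<in> maximum_indep_sets G"
    unfolding well_covered_def maximum_indep_sets_def inclusion_maximal_def by blast
  with M that show ?thesis by blast
qed

text \<open>A maximum independent set is itself a facet, so the common facet size can only be
  \<open>r\<close>.\<close>

lemma well_covered_iff_pure: "well_covered G \<longleftrightarrow> pure_complex I"
proof
  assume "pure_complex I"
  moreover obtain M where M: "M \<in> maximum_indep_sets G"
    by (rule maximum_indep_exists)
  ultimately have "card S = card M" if "S \<in> inclusion_maximal I" for S
    using that maximum_imp_maximal unfolding pure_complex_def by blast
  with M show "well_covered G"
    unfolding well_covered_def maximum_indep_sets_def by auto
qed (auto simp: well_covered_def pure_complex_def)

section \<open>The one-vertex extensions of an independent set\<close>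

lemma ext_set_subset: "F S \<subseteq> verts G"
  unfolding ext_set_def by blast

lemma finite_ext_set: "finite (F S)"
  using ext_set_subset fin_verts finite_subset by blast

text \<open>As \<open>r \<ge> 1\<close>, the subtraction is exact, so every independent one-vertex
  extension of \<open>S\<close> already has size \<open>r\<close>.\<close>

lemma ext_set_iff:
  assumes "S \<in> I" "card S = r - 1"
  shows "x \<in> F S \<longleftrightarrow> x \<notin> S \<and> insert x S \<in> I"
  using assms indep_number_pos indep_finite[OF assms(1)]
  by (auto simp: ext_set_def maximum_indep_sets_def indep_sets_def)

lemma ext_set_card:
  assumes "x \<in> F S" shows "card S + 1 = r"
proof -
  have x: "x \<notin> S" "insert x S \<in> I" "card (insert x S) = r"
    using assms unfolding ext_set_def maximum_indep_sets_def by auto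
  then show ?thesis
    using indep_finite[OF x(2)] by simp
qed

lemma ext_set_clique:
  assumes x: "x \<in> F S" and y: "y \<in> F S" and "x \<noteq> y"
  shows "{x, y} \<in> edges G"
proof -
  have xS: "insert x S \<in> I" "x \<notin> S" and yS: "insert y S \<in> I" "y \<notin> S"
    using x y unfolding ext_set_def maximum_indep_sets_def by auto
  have "finite S"
    using indep_finite[OF xS(1)] by simp
  then have "card (insert x (insert y S)) = r + 1"
    using xS yS \<open>x \<noteq> y\<close> ext_set_card[OF x] by simp
  then have "insert x (insert y S) \<notin> I"
    using indep_card_le by fastforce
  then obtain e where e: "e \<in> edges G" "e \<subseteq> insert x (insert y S)"
    using xS yS unfolding indep_sets_def by auto
  \<comment> \<open>An edge missing \<open>x\<close> or \<open>y\<close> would lie in one of the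
    independent sets \<open>insert y S\<close>, \<open>insert x S\<close>.\<close>
  then have "x \<in> e" "y \<in> e"
    using xS yS unfolding indep_sets_def by blast+
  then have "{x, y} = e"
    using edge_card[OF e(1)] \<open>x \<noteq> y\<close> by (auto simp: card_2_iff)
  with e show ?thesis by simp
qed

text \<open>A clique and an independent set share at most one vertex.\<close>

lemma card_ext_set_inter_le:
  assumes "B \<in> I" shows "card (F S \<inter> B) \<le> 1"
proof -
  have "x = y" if "x \<in> F S \<inter> B" "y \<in> F S \<inter> B" for x y
  proof (rule ccontr)
    assume "x \<noteq> y"
    with that have "{x, y} \<in> edges G" "{x, y} \<subseteq> B"
      using ext_set_clique by auto
    with assms show False
      unfolding indep_sets_def by blast
  qed
  then show ?thesis
    by (simp add: card_le_Suc0_iff_eq finite_ext_set)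
qed

section \<open>Disjoint extensions and the class \<open>W_class\<close>\<close>

text \<open>A set \<open>S\<close> maximal among the independent sets avoiding all
  \<open>B j\<close> is already maximum: otherwise some \<open>F T\<close> with
  \<open>S \<subseteq> T\<close> has at least \<open>p\<close> vertices, the fewer than
  \<open>p\<close> sets \<open>B j\<close> cover at most one each, and a remaining vertex enlarges
  \<open>S\<close>.\<close>

lemma extend_avoiding:
  assumes wc: "well_covered G"
    and big: "\<And>S. S \<in> I \<Longrightarrow> card S = r - 1 \<Longrightarrow> p \<le> card (F S)"
    and A: "A \<in> I" "A \<inter> (\<Union>j\<in>J. B j) = {}"
    and J: "finite J" "card J < p" "\<And>j. j \<in> J \<Longrightarrow> B j \<in> I"
  obtains M where "M \<in> maximum_indep_sets G" "A \<subseteq> M" "M \<inter> (\<Union>j\<in>J. B j) = {}"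
proof -
  define U where "U = (\<Union>j\<in>J. B j)"
  define K where "K = {T \<in> I. T \<inter> U = {}}"
  have "finite K" "A \<in> K"
    using finite_indep_sets A unfolding K_def U_def by auto
  then obtain S where S: "S \<in> inclusion_maximal K" "A \<subseteq> S"
    by (rule inclusion_maximal_above)
  have SI: "S \<in> I" "S \<inter> U = {}"
    using S unfolding inclusion_maximal_def K_def by auto
  obtain M where M: "M \<in> maximum_indep_sets G" "S \<subseteq> M"
    using well_covered_extend[OF wc SI(1)] .
  have MI: "M \<in> I" "card M = r"
    using M unfolding maximum_indep_sets_def by auto
  have "S = M"
  proof (rule ccontr)
    assume "S \<noteq> M"
    then obtain u where u: "u \<in> M" "u \<notin> S"
      using M by blast
    define T where "T = M - {u}"
    have T: "T \<in> I" "card T = r - 1" "S \<subseteq> T"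
      using MI u M indep_sets_subset[OF MI(1), of T] unfolding T_def by auto
    have "F T \<inter> U = (\<Union>j\<in>J. F T \<inter> B j)"
      unfolding U_def by blast
    then have "card (F T \<inter> U) \<le> (\<Sum>j\<in>J. card (F T \<inter> B j))"
      using card_UN_le[OF J(1)] by metis
    also have "\<dots> \<le> card J"
      using sum_mono[of J "\<lambda>j. card (F T \<inter> B j)" "\<lambda>_. 1"] J(3) card_ext_set_inter_le by simp
    also have "\<dots> < card (F T)"
      using J(2) big[OF T(1,2)] by linarith
    finally have "F T \<inter> U \<noteq> F T"
      by auto
    then obtain w where w: "w \<in> F T" "w \<notin> U"
      by blast
    have "w \<notin> T" "insert w T \<in> I"
      using w ext_set_iff[OF T(1,2)] by auto
    moreover from this have "insert w S \<in> K"
      using T(3) w SI indep_sets_subset[of "insert w T" G "insert w S"] unfolding K_def by auto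
    ultimately show False
      using S(1) T(3) unfolding inclusion_maximal_def by blast
  qed
  with M(1) S(2) SI(2) that show ?thesis
    unfolding U_def by blast
qed

lemma W_class_iff:
  assumes "p \<ge> 1"
  shows "G \<in> W_class p \<longleftrightarrow>
    well_covered G \<and> (\<forall>S\<in>I. card S = r - 1 \<longrightarrow> p \<le> card (F S))"
proof
  assume W: "G \<in> W_class p"
  have ext: "\<exists>M. (\<forall>i<p. M i \<in> maximum_indep_sets G \<and> A i \<subseteq> M i) \<and> disjoint_family_on M {..<p}"
    if "\<forall>i<p. A i \<in> I" "disjoint_family_on A {..<p}" for A
    using W that unfolding W_class_def by blast
  have "card S = r" if S: "S \<in> inclusion_maximal I" for S
  proof -
    \<comment> \<open>Padding with empty sets makes a single set a legitimate family.\<close>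
    define A where "A i = (if i = 0 then S else {})" for i :: nat
    have "\<forall>i<p. A i \<in> I" "disjoint_family_on A {..<p}"
      using S empty_indep unfolding A_def inclusion_maximal_def disjoint_family_on_def by auto
    from ext[OF this] obtain M where "\<And>i. i < p \<Longrightarrow> M i \<in> maximum_indep_sets G \<and> A i \<subseteq> M i"
      by blast
    from this[of 0] have "M 0 \<in> maximum_indep_sets G" "S \<subseteq> M 0"
      using assms unfolding A_def by auto
    with S show ?thesis
      unfolding inclusion_maximal_def maximum_indep_sets_def by blast
  qed
  then have "well_covered G"
    unfolding well_covered_def by blast
  moreover have "p \<le> card (F S)" if S: "S \<in> I" "card S = r - 1" for S
  proof (rule ccontr)
    assume less: "\<not> p \<le> card (F S)"
    obtain f where f: "bij_betw f {..<card (F S)} (F S)"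
      using ex_bij_betw_nat_finite[OF finite_ext_set] by (auto simp: atLeast0LessThan)
    \<comment> \<open>\<open>S\<close> takes index 0, the vertices of \<open>F S\<close> the indices
      from 1 to \<open>card (F S)\<close>, which is below \<open>p\<close>; all later indices get
      the empty set.\<close>
    define A where "A i = (if i = 0 then S else if i - 1 < card (F S) then {f (i - 1)} else {})"
      for i :: nat
    have fF: "f i \<in> F S" if "i < card (F S)" for i
      using f that unfolding bij_betw_def by auto
    have "A i \<in> I" if "i < p" for i
      using S fF[of "i - 1"] ext_set_subset empty_indep singleton_indep unfolding A_def by auto
    moreover have "disjoint_family_on A {..<p}"
      unfolding disjoint_family_on_def
    proof (intro ballI impI)
      fix i j :: nat
      assume "i \<noteq> j"
      moreover have "f (k - 1) \<notin> S" if "k - 1 < card (F S)" for k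
        using fF[OF that] unfolding ext_set_def by blast
      \<comment> \<open>Positivity matters: truncated subtraction sends both 0 and 1 to 0.\<close>
      moreover have "f (i - 1) \<noteq> f (j - 1)"
        if "i - 1 < card (F S)" "j - 1 < card (F S)" "0 < i" "0 < j"
      proof -
        have "i - 1 \<noteq> j - 1"
          using \<open>i \<noteq> j\<close> that by linarith
        then show ?thesis
          using f that unfolding bij_betw_def inj_on_def by blast
      qed
      ultimately show "A i \<inter> A j = {}"
        unfolding A_def by auto
    qed
    ultimately obtain M where M: "\<And>i. i < p \<Longrightarrow> M i \<in> maximum_indep_sets G \<and> A i \<subseteq> M i"
      "disjoint_family_on M {..<p}"
      using ext[of A] by blast
    have M0: "M 0 \<in> maximum_indep_sets G" "S \<subseteq> M 0"
      using M(1)[of 0] assms unfolding A_def by auto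
    then have M0I: "M 0 \<in> I" "card (M 0) = r"
      unfolding maximum_indep_sets_def by auto
    \<comment> \<open>\<open>M 0\<close> has one vertex more than \<open>S\<close>. That vertex lies
      in \<open>F S\<close>, so another member of the family already owns it.\<close>
    then obtain x where x: "x \<in> M 0" "x \<notin> S"
      using card_mono[OF indep_finite[OF S(1)], of "M 0"] S(2) indep_number_pos by fastforce
    then have "x \<in> F S"
      using ext_set_iff[OF S] indep_sets_subset[OF M0I(1), of "insert x S"] M0 by blast
    then obtain i where i: "i < card (F S)" "x = f i"
      using f unfolding bij_betw_def by auto
    then have "x \<in> M (Suc i)" "Suc i < p"
      using M(1)[of "Suc i"] less unfolding A_def by auto
    moreover from this have "M 0 \<inter> M (Suc i) = {}"
      by (intro disjoint_family_onD[OF M(2)]) auto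
    ultimately show False
      using x by blast
  qed
  ultimately show "well_covered G \<and> (\<forall>S\<in>I. card S = r - 1 \<longrightarrow> p \<le> card (F S))"
    by blast
next
  assume R: "well_covered G \<and> (\<forall>S\<in>I. card S = r - 1 \<longrightarrow> p \<le> card (F S))"
  \<comment> \<open>One such \<open>S\<close> gives the size condition, since \<open>F S\<close>
    consists of vertices.\<close>
  obtain S where "S \<in> I" "card S = r - 1"
    using indep_of_card_exists[of "r - 1"] by auto
  then have "p \<le> card (verts G)"
    using R card_mono[OF fin_verts ext_set_subset] le_trans by blast
  moreover have "\<exists>M. (\<forall>i<p. M i \<in> maximum_indep_sets G \<and> A i \<subseteq> M i) \<and> disjoint_family_on M {..<p}"
    if A: "\<forall>i<p. A i \<in> I" "disjoint_family_on A {..<p}" for A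
  proof -
    \<comment> \<open>Invariant: all \<open>p\<close> sets stay independent and disjoint, and the
      first \<open>k\<close> are already maximum. Each step enlarges \<open>M k\<close> away from
      the other \<open>p - 1\<close> sets.\<close>
    have "\<exists>M. (\<forall>i<p. M i \<in> I \<and> A i \<subseteq> M i) \<and> (\<forall>i<k. M i \<in> maximum_indep_sets G)
        \<and> disjoint_family_on M {..<p}" if "k \<le> p" for k
      using that
    proof (induction k)
      case 0
      with A show ?case by auto
    next
      case (Suc k)
      then obtain M where M: "\<And>i. i < p \<Longrightarrow> M i \<in> I \<and> A i \<subseteq> M i"
        "\<And>i. i < k \<Longrightarrow> M i \<in> maximum_indep_sets G" "disjoint_family_on M {..<p}"
        by auto
      have k: "k < p"
        using Suc.prems by simp
      have "M k \<inter> (\<Union>j\<in>{..<p} - {k}. M j) = {}"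
        using M(3) k unfolding disjoint_family_on_def by blast
      then obtain T where T: "T \<in> maximum_indep_sets G" "M k \<subseteq> T"
        "T \<inter> (\<Union>j\<in>{..<p} - {k}. M j) = {}"
        using extend_avoiding[of p "M k" M "{..<p} - {k}"] R M(1) k by auto
      have "\<forall>i<p. (M(k := T)) i \<in> I \<and> A i \<subseteq> (M(k := T)) i"
        using M(1) T k unfolding maximum_indep_sets_def by auto
      moreover have "\<forall>i<Suc k. (M(k := T)) i \<in> maximum_indep_sets G"
        using M(2) T(1) by (auto simp: less_Suc_eq)
      moreover have "disjoint_family_on (M(k := T)) {..<p}"
        using M(3) T(3) unfolding disjoint_family_on_def by auto
      ultimately show ?case by blast
    qed
    from this[OF order_refl] show ?thesis by auto
  qed
  ultimately show "G \<in> W_class p"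
    using fsg unfolding W_class_def by blast
qed

section \<open>Critical edges\<close>

text \<open>Makes the facts about independent sets available for the graph without
  \<open>e\<close>.\<close>

lemma fin_graph_delete_edge: "fin_graph (delete_edge G e)"
  using fsg unfolding fin_graph_def finite_simple_graph_def delete_edge_def by auto

text \<open>Subsets of independent sets are independent, so a larger independence number yields a
  set of size exactly \<open>r + 1\<close>.\<close>

lemma alpha_critical_edge_iff_indep:
  "alpha_critical_edge G e \<longleftrightarrow> (\<exists>T\<in>indep_sets (delete_edge G e). card T = r + 1)"
proof -
  interpret D: fin_graph "delete_edge G e"
    by (rule fin_graph_delete_edge)
  show ?thesis
    unfolding alpha_critical_edge_def
    using D.indep_of_card_exists[of "r + 1"] D.indep_card_le by fastforce
qed

text \<open>The independent sets \<open>T\<close> of size \<open>r + 1\<close> in the graph without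
  \<open>e\<close> correspond to the sets \<open>S\<close> via \<open>S = T - e\<close> and
  \<open>T = S \<union> e\<close>.\<close>

lemma alpha_critical_edge_iff_ext_set:
  assumes e: "e \<in> edges G"
  shows "alpha_critical_edge G e \<longleftrightarrow> (\<exists>S\<in>I. card S = r - 1 \<and> e \<subseteq> F S)"
proof
  assume "alpha_critical_edge G e"
  then obtain T where T: "T \<subseteq> verts G" "\<And>f. f \<in> edges G - {e} \<Longrightarrow> \<not> f \<subseteq> T" "card T = r + 1"
    unfolding alpha_critical_edge_iff_indep indep_sets_def delete_edge_def by auto
  then have "T \<notin> I"
    using indep_card_le by fastforce
  \<comment> \<open>\<open>T\<close> is dependent in \<open>G\<close>, and \<open>e\<close> is the
    only edge it can contain; removing either endpoint of \<open>e\<close> therefore restores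
    independence.\<close>
  with T have eT: "e \<subseteq> T"
    unfolding indep_sets_def by blast
  have finT: "finite T"
    using T(3) card.infinite by fastforce
  have sub: "T - {x} \<in> I" if "x \<in> e" for x
    using T that unfolding indep_sets_def by blast
  obtain x y where xy: "e = {x, y}" "x \<noteq> y"
    using edge_card[OF e] by (auto simp: card_2_iff)
  have S: "T - e \<in> I" "card (T - e) = r - 1"
    using sub[of x] indep_sets_subset[of "T - {x}" G "T - e"] xy eT T(3)
      card_Diff_subset[of e T] edge_card[OF e] finite_subset[OF eT finT] by auto
  have "insert x (T - e) = T - {y}" "insert y (T - e) = T - {x}"
    using xy eT by auto
  then have "e \<subseteq> F (T - e)"
    using ext_set_iff[OF S] sub xy by auto
  with S show "\<exists>S\<in>I. card S = r - 1 \<and> e \<subseteq> F S" by blast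
next
  assume "\<exists>S\<in>I. card S = r - 1 \<and> e \<subseteq> F S"
  then obtain S where S: "S \<in> I" "card S = r - 1" "e \<subseteq> F S" by blast
  obtain x y where xy: "e = {x, y}" "x \<noteq> y"
    using edge_card[OF e] by (auto simp: card_2_iff)
  have xS: "x \<notin> S" "insert x S \<in> I" and yS: "y \<notin> S" "insert y S \<in> I"
    using S xy ext_set_iff[OF S(1,2)] by auto
  have "f = e" if f: "f \<in> edges G" "f \<subseteq> insert x (insert y S)" for f
  proof -
    have "x \<in> f" "y \<in> f"
      using f xS yS unfolding indep_sets_def by blast+
    then show ?thesis
      using edge_card[OF f(1)] xy by (auto simp: card_2_iff)
  qed
  then have "insert x (insert y S) \<in> indep_sets (delete_edge G e)"
    using xS yS unfolding indep_sets_def delete_edge_def by auto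
  moreover have "card (insert x (insert y S)) = r + 1"
    using xS yS xy S(2) indep_finite[OF S(1)] indep_number_pos by simp
  ultimately show "alpha_critical_edge G e"
    unfolding alpha_critical_edge_iff_indep by blast
qed

lemma alpha_critical_iff:
  "alpha_critical G \<longleftrightarrow> (\<forall>e\<in>edges G. \<exists>S\<in>I. card S = r - 1 \<and> e \<subseteq> F S)"
  unfolding alpha_critical_def by (simp add: alpha_critical_edge_iff_ext_set)

text \<open>The sets \<open>F S\<close> are cliques, so the union always consists of edges;
  criticality is the other inclusion.\<close>

lemma alpha_critical_iff_edges_eq:
  "alpha_critical G \<longleftrightarrow> edges G = (\<Union>S\<in>{S \<in> I. card S = r - 1}. [F S]\<^bsup>2\<^esup>)"
proof -
  have "[F S]\<^bsup>2\<^esup> \<subseteq> edges G" for S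
    using ext_set_clique by (auto simp: nsets_2_iff card_2_iff)
  then have "edges G = (\<Union>S\<in>{S \<in> I. card S = r - 1}. [F S]\<^bsup>2\<^esup>) \<longleftrightarrow>
      edges G \<subseteq> (\<Union>S\<in>{S \<in> I. card S = r - 1}. [F S]\<^bsup>2\<^esup>)"
    by blast
  also have "\<dots> \<longleftrightarrow> alpha_critical G"
    unfolding alpha_critical_iff subset_iff[of "edges G"] using edge_card
    by (simp add: nsets_2_iff Ball_def Bex_def conj_assoc)
  finally show ?thesis ..
qed

section \<open>The independence complex\<close>

text \<open>A non-face contains an edge, which fills it if it has two elements; a proper subset of
  an edge is too small to contain one.\<close>

lemma missing_edges_eq: "missing_edges I = edges G"
proof (intro set_eqI iffI)
  fix e assume e: "e \<in> missing_edges I"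
  then obtain x y where xy: "e = {x, y}" "x \<noteq> y"
    unfolding missing_edges_def by (auto simp: card_2_iff)
  then have "{x} \<in> I" "{y} \<in> I"
    using e unfolding missing_edges_def by blast+
  then obtain f where f: "f \<in> edges G" "f \<subseteq> e"
    using e xy unfolding missing_edges_def singleton_indep indep_sets_def by auto
  then have "f = e"
    using edge_card[OF f(1)] xy by (intro card_subset_eq) auto
  with f show "e \<in> edges G" by simp
next
  fix e assume e: "e \<in> edges G"
  then have fin: "finite e"
    using edge_verts fin_verts finite_subset by blast
  have "T \<in> I" if T: "T \<subset> e" for T
  proof -
    have "\<not> f \<subseteq> T" if "f \<in> edges G" for f
    proof
      assume "f \<subseteq> T"
      with T have "f \<subset> e" by blast
      from psubset_card_mono[OF fin this] show False
        using edge_card e that by simp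
    qed
    then show ?thesis
      using edge_verts[OF e] T unfolding indep_sets_def by blast
  qed
  with e show "e \<in> missing_edges I"
    unfolding missing_edges_def using edge_card[OF e] by (auto simp: indep_sets_def)
qed

text \<open>All facets have size \<open>r\<close>, and a maximum independent set shows that there is
  one.\<close>

lemma ridges_eq:
  assumes "well_covered G" shows "ridges I = {S \<in> I. card S = r - 1}"
proof -
  obtain M where "M \<in> maximum_indep_sets G"
    by (rule maximum_indep_exists)
  then have "M \<in> inclusion_maximal I" "card M = r"
    using maximum_imp_maximal unfolding maximum_indep_sets_def by auto
  moreover have "card N = r" if "N \<in> inclusion_maximal I" for N
    using that assms unfolding well_covered_def by blast
  ultimately have "(\<exists>N\<in>inclusion_maximal I. card N = card S + 1) \<longleftrightarrow> card S = r - 1" for S :: "'a set"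
    using indep_number_pos by (metis Nat.add_diff_assoc2 add_diff_cancel_right' le_add_diff_inverse2)
  then show ?thesis
    unfolding ridges_def by blast
qed

lemma complex_verts_link:
  assumes "S \<in> I" "card S = r - 1"
  shows "complex_verts (link I S) = F S"
  using ext_set_iff[OF assms] indep_sets_subset[of "insert x S" G "{x}" for x]
  unfolding complex_verts_def link_def by auto

section \<open>Cliques of the complement\<close>

lemma clique_sets_complement: "clique_sets (complement_graph G) = I"
proof -
  have "[Q]\<^bsup>2\<^esup> \<subseteq> [verts G]\<^bsup>2\<^esup> - edges G \<longleftrightarrow> (\<forall>e\<in>edges G. \<not> e \<subseteq> Q)" if "Q \<subseteq> verts G" for Q
    using that edge_card unfolding subset_iff[of "[Q]\<^bsup>2\<^esup>"] Diff_iff nsets_2_iff by (meson order_trans)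
  then show ?thesis
    unfolding clique_sets_def complement_graph_def indep_sets_def by auto
qed

text \<open>Turns cliques after adding a non-edge into independent sets after deleting an edge of
  \<open>G\<close>.\<close>

lemma add_edge_complement:
  assumes "e \<in> edges G"
  shows "add_edge (complement_graph G) e = complement_graph (delete_edge G e)"
  using assms edge_card edge_verts
  unfolding add_edge_def complement_graph_def delete_edge_def by (auto simp: nsets_2_iff)

lemma nonedges_complement:
  "[verts (complement_graph G)]\<^bsup>2\<^esup> - edges (complement_graph G) = edges G"
  using edge_card edge_verts unfolding complement_graph_def by (auto simp: nsets_2_iff)

text \<open>Maximality of \<open>r\<close> excludes \<open>(r + 1)\<close>-cliques; one created by
  adding \<open>e\<close> is an independent set witnessing that \<open>e\<close> is
  critical.\<close>

lemma clique_saturated_complement_iff: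
  "clique_saturated (r + 1) (complement_graph G) \<longleftrightarrow> alpha_critical G"
proof -
  have "k_cliques (r + 1) (complement_graph G) = {}"
    unfolding k_cliques_def clique_sets_complement using indep_card_le by fastforce
  moreover have "k_cliques (r + 1) (add_edge (complement_graph G) e) \<noteq> {} \<longleftrightarrow> alpha_critical_edge G e"
    if "e \<in> edges G" for e
    unfolding add_edge_complement[OF that] k_cliques_def
      fin_graph.clique_sets_complement[OF fin_graph_delete_edge] alpha_critical_edge_iff_indep
    by blast
  ultimately show ?thesis
    unfolding clique_saturated_def nonedges_complement alpha_critical_def by simp
qed

lemma clique_codegree_complement:
  assumes "S \<in> I" "card S = r - 1"
  shows "clique_codegree (complement_graph G) S = card (F S)"
  unfolding clique_codegree_def k_cliques_def clique_sets_complement ext_set_def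
    maximum_indep_sets_def
  using assms indep_number_pos by (simp add: complement_graph_def)

text \<open>Subsets of a maximum independent set provide an \<open>(r - 1)\<close>-clique, so the
  minimum ranges over a non-empty finite set.\<close>

lemma min_clique_codegree_complement_ge_iff:
  "p \<le> min_clique_codegree (r - 1) (complement_graph G) \<longleftrightarrow>
    (\<forall>S\<in>I. card S = r - 1 \<longrightarrow> p \<le> card (F S))"
proof -
  have "k_cliques (r - 1) (complement_graph G) = {S \<in> I. card S = r - 1}"
    unfolding k_cliques_def clique_sets_complement ..
  moreover have "{S \<in> I. card S = r - 1} \<noteq> {}"
    using indep_of_card_exists[of "r - 1"] by auto
  ultimately show ?thesis
    unfolding min_clique_codegree_def
    using finite_indep_sets clique_codegree_complement by (subst Min_ge_iff) auto
qed

end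

theorem theorem5p1:
  fixes G H :: "'a graph" and \<Delta> :: "'a set set" and p r :: nat
  defines "r \<equiv> indep_number G"
    and "\<Delta> \<equiv> indep_sets G"
    and "H \<equiv> complement_graph G"
  assumes "p \<ge> 1"
    and "finite_simple_graph G"
  defines "a \<equiv> alpha_critical G \<and> G \<in> W_class p"
    and "b \<equiv> pure_complex \<Delta>
         \<and> (\<forall>S\<in>ridges \<Delta>. ridge_degree \<Delta> S \<ge> p)
         \<and> (\<forall>e\<in>missing_edges \<Delta>. \<exists>S\<in>ridges \<Delta>. e \<subseteq> complex_verts (link \<Delta> S))"
    and "c \<equiv> well_covered G
         \<and> (\<forall>S\<in>indep_sets G. card S = r - 1 \<longrightarrow> card (ext_set G S) \<ge> p)
         \<and> edges G = (\<Union>S\<in>{S \<in> indep_sets G. card S = r - 1}. [ext_set G S]\<^bsup>2\<^esup>)"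
    and "d \<equiv> clique_saturated (r + 1) H
         \<and> (\<forall>Q\<in>inclusion_maximal (clique_sets H). card Q = r)
         \<and> min_clique_codegree (r - 1) H \<ge> p"
  shows "(a \<longleftrightarrow> b) \<and> (b \<longleftrightarrow> c) \<and> (c \<longleftrightarrow> d)"
proof -
  interpret fin_graph G
    using \<open>finite_simple_graph G\<close> by unfold_locales
  \<comment> \<open>Each of the four conditions is reduced to this common form.\<close>
  let ?P = "alpha_critical G \<and> well_covered G \<and> (\<forall>S\<in>I. card S = indep_number G - 1 \<longrightarrow> p \<le> card (F S))"
  have "a \<longleftrightarrow> ?P"
    unfolding a_def W_class_iff[OF \<open>p \<ge> 1\<close>] by blast
  moreover have "b \<longleftrightarrow> ?P"
  \<comment> \<open>Ridges are identified with the independent sets of size \<open>r - 1\<close>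
    only under purity; without it both sides are false.\<close>
  proof (cases "well_covered G")
    case True
    then show ?thesis
      unfolding b_def \<Delta>_def well_covered_iff_pure[symmetric] missing_edges_eq ridge_degree_def
        alpha_critical_iff ridges_eq[OF True]
      by (auto simp: complex_verts_link)
  qed (simp add: b_def \<Delta>_def well_covered_iff_pure)
  moreover have "c \<longleftrightarrow> ?P"
    unfolding c_def r_def alpha_critical_iff_edges_eq by blast
  moreover have "d \<longleftrightarrow> ?P"
    unfolding d_def r_def H_def clique_saturated_complement_iff clique_sets_complement
      min_clique_codegree_complement_ge_iff well_covered_def by blast
  ultimately show ?thesis by blast
qed

end
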